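(* Let $S$ be a multiplicatively closed subset of a ring $R$ and let $N$ be a submodule of an $R$-module $M$ with $(N:_{R}M)\cap S=\emptyset$. The following conditions are equivalent. (1) $N$ is a weakly $S$-prime submodule of $M$. (2) There exists $s\in S$ such that for each $a\in R$ with $a\notin(N:_{R}sM)$, either $(N:_{M}a)=(0:_{M}a)$ or $(N:_{M}a)\subseteq(N:_{M}s)$. (3) There exists $s\in S$ such that for any $a\in R$ and any submodule $K$ of $M$, if $0\neq aK\subseteq N$, then $sa\in(N:_{R}M)$ or $sK\subseteq N$. (4) There exists $s\in S$ such that for any ideal $I$ of $R$ and any submodule $K$ of $M$, if $0\neq IK\subseteq N$, then $sI\subseteq(N:_{R}M)$ or $sK\subseteq N$.
   Context: Rings are commutative with non-zero identity and modules are unital. A non-empty subset $S$ of $R$ is multiplicatively closed if it is closed under multiplication. For a submodule $N$ of $M$ and a submodule $K$ of $M$, $(N:_{R}K)=\{r\in R: rK\subseteq N\}$; for $a\in R$, $(N:_{M}a)=\{m\in M: am\in N\}$. A submodule $N$ of $M$ with $(N:_{R}M)\cap S=\emptyset$ is weakly $S$-prime if there exists a fixed $s\in S$ such that for all $a\in R$, $m\in M$ with $0\neq am\in N$, either $sa\in(N:_{R}M)$ or $sm\in N$. *)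

theory Defs
  imports "HOL-Algebra.Module" "HOL-Algebra.Ideal"
begin

text \<open>Rings and modules are those of the locale \<open>module R M\<close> (so \<open>R\<close> is a \<open>cring\<close> and \<open>M\<close> is
  unital). The locale \<open>cring\<close> admits the zero ring; non-triviality has to be assumed separately.\<close>

text \<open>Some authors also demand \<open>\<one>\<^bsub>R\<^esub> \<in> S\<close>; here non-emptiness is enough.\<close>
definition mult_closed_subset :: "('a, 'r) ring_scheme \<Rightarrow> 'a set \<Rightarrow> bool"
  where "mult_closed_subset R S \<longleftrightarrow>
    S \<subseteq> carrier R \<and> S \<noteq> {} \<and> (\<forall>s\<in>S. \<forall>t\<in>S. s \<otimes>\<^bsub>R\<^esub> t \<in> S)"

text \<open>\<open>a K = {a k | k \<in> K}\<close>; it is already a submodule when \<open>K\<close> is one.\<close>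
definition elt_smult :: "('a, 'b, 'm) module_scheme \<Rightarrow> 'a \<Rightarrow> 'b set \<Rightarrow> 'b set"
  where "elt_smult M a K = (\<lambda>k. a \<odot>\<^bsub>M\<^esub> k) ` K"

text \<open>\<open>I K\<close> is the set of finite sums of products \<open>i k\<close>, in the style of \<open>ideal_prod\<close>. For an ideal
  \<open>I\<close> and a submodule \<open>K\<close>, closure under addition makes this a submodule.\<close>
inductive_set ideal_smult :: "('a, 'b, 'm) module_scheme \<Rightarrow> 'a set \<Rightarrow> 'b set \<Rightarrow> 'b set"
  for M and I and K where
    prod: "\<lbrakk> i \<in> I; k \<in> K \<rbrakk> \<Longrightarrow> i \<odot>\<^bsub>M\<^esub> k \<in> ideal_smult M I K"
  | sum: "\<lbrakk> x \<in> ideal_smult M I K; y \<in> ideal_smult M I K \<rbrakk> \<Longrightarrow> x \<oplus>\<^bsub>M\<^esub> y \<in> ideal_smult M I K"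

definition ring_colon ::
    "('a, 'r) ring_scheme \<Rightarrow> ('a, 'b, 'm) module_scheme \<Rightarrow> 'b set \<Rightarrow> 'b set \<Rightarrow> 'a set"
  where "ring_colon R M N K = {r \<in> carrier R. elt_smult M r K \<subseteq> N}"

definition mod_colon :: "('a, 'b, 'm) module_scheme \<Rightarrow> 'b set \<Rightarrow> 'a \<Rightarrow> 'b set"
  where "mod_colon M N a = {m \<in> carrier M. a \<odot>\<^bsub>M\<^esub> m \<in> N}"

definition weakly_S_prime ::
    "('a, 'r) ring_scheme \<Rightarrow> ('a, 'b, 'm) module_scheme \<Rightarrow> 'a set \<Rightarrow> 'b set \<Rightarrow> bool"
  where "weakly_S_prime R M S N \<longleftrightarrow>
    submodule N R M \<and> ring_colon R M N (carrier M) \<inter> S = {} \<and>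
    (\<exists>s\<in>S. \<forall>a\<in>carrier R. \<forall>m\<in>carrier M.
      a \<odot>\<^bsub>M\<^esub> m \<noteq> \<zero>\<^bsub>M\<^esub> \<and> a \<odot>\<^bsub>M\<^esub> m \<in> N \<longrightarrow>
        s \<otimes>\<^bsub>R\<^esub> a \<in> ring_colon R M N (carrier M) \<or> s \<odot>\<^bsub>M\<^esub> m \<in> N)"

end

theory Submission
  imports Defs
begin

text \<open>
  All four conditions have the form "there is an \<open>s \<in> S\<close> such that ...", and they are
  in fact equivalent for each fixed \<open>s\<close>; no change of \<open>s\<close> occurs. So the work is done
  for one element \<open>s\<close> of the ring, with \<open>prime_witness\<close> as the condition in
  the definition of a weakly \<open>S\<close>-prime submodule.

  The zero products, on which that definition says nothing, are handled both times by the same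
  perturbation: to learn something about an element with zero product, add to it one with non-zero
  product. The sum has the same non-zero product, so the hypothesis applies to the sum, and the
  added element can then be cancelled modulo a submodule or an ideal. In
  \<open>prime_witness_colon_dichotomy\<close> the perturbed element is a vector. It is a scalar in
  \<open>prime_witness_imp_ideal_smult_condition\<close>: if \<open>i\<close> in an ideal \<open>I\<close> has
  \<open>s i \<notin> (N : M)\<close> but \<open>i K = 0\<close>, choose \<open>j \<in> I\<close> with
  \<open>j K \<noteq> 0\<close>; then either \<open>j\<close> or \<open>i + j\<close> has the two properties at once,
  and the condition for single scalars gives \<open>s K \<subseteq> N\<close>.

  The conditions on submodules and ideals return to the one on elements by
  specialisation to the cyclic submodule \<open>R m\<close> and the principal ideal \<open>R a\<close>.
\<close>

definition prime_witness ::
    "('a, 'r) ring_scheme \<Rightarrow> ('a, 'b, 'm) module_scheme \<Rightarrow> 'b set \<Rightarrow> 'a \<Rightarrow> bool"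
  where "prime_witness R M N s \<longleftrightarrow>
    (\<forall>a\<in>carrier R. \<forall>m\<in>carrier M.
      a \<odot>\<^bsub>M\<^esub> m \<noteq> \<zero>\<^bsub>M\<^esub> \<and> a \<odot>\<^bsub>M\<^esub> m \<in> N \<longrightarrow>
        s \<otimes>\<^bsub>R\<^esub> a \<in> ring_colon R M N (carrier M) \<or> s \<odot>\<^bsub>M\<^esub> m \<in> N)"

definition cyclic_submodule ::
    "('a, 'r) ring_scheme \<Rightarrow> ('a, 'b, 'm) module_scheme \<Rightarrow> 'b \<Rightarrow> 'b set"
  where "cyclic_submodule R M m = (\<lambda>r. r \<odot>\<^bsub>M\<^esub> m) ` carrier R"

context module
begin

section \<open>Submodules, colons and products\<close>

lemma submodule_zero_closed: "submodule H R M \<Longrightarrow> \<zero>\<^bsub>M\<^esub> \<in> H"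
  using subgroup.one_closed[OF submodule.axioms(1), of H R M] by simp

lemma submodule_add_cancel:
  assumes H: "submodule H R M" and x: "x \<in> H" and y: "y \<in> carrier M"
    and xy: "x \<oplus>\<^bsub>M\<^esub> y \<in> H"
  shows "y \<in> H"
proof -
  have "x \<in> carrier M" using submoduleE(1)[OF H] x by blast
  then have "y = \<ominus>\<^bsub>M\<^esub> x \<oplus>\<^bsub>M\<^esub> (x \<oplus>\<^bsub>M\<^esub> y)"
    using y by (simp add: M.r_neg1)
  then show ?thesis
    using submoduleE(5)[OF H submoduleE(3)[OF H x] xy] by simp
qed

lemma cyclic_submodule_is_submodule:
  assumes m: "m \<in> carrier M"
  shows "submodule (cyclic_submodule R M m) R M"
proof (rule submoduleI)
  show "cyclic_submodule R M m \<subseteq> carrier M"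
    using m by (auto simp: cyclic_submodule_def)
  show "\<zero>\<^bsub>M\<^esub> \<in> cyclic_submodule R M m"
    unfolding cyclic_submodule_def using m by (intro image_eqI[of _ _ \<zero>]) auto
next
  fix x assume "x \<in> cyclic_submodule R M m"
  then obtain r where "r \<in> carrier R" "x = r \<odot>\<^bsub>M\<^esub> m"
    by (auto simp: cyclic_submodule_def)
  then show "\<ominus>\<^bsub>M\<^esub> x \<in> cyclic_submodule R M m"
    unfolding cyclic_submodule_def using m
    by (intro image_eqI[of _ _ "\<ominus> r"]) (auto simp: smult_l_minus)
next
  fix x y assume "x \<in> cyclic_submodule R M m" "y \<in> cyclic_submodule R M m"
  then obtain r t where "r \<in> carrier R" "x = r \<odot>\<^bsub>M\<^esub> m" "t \<in> carrier R" "y = t \<odot>\<^bsub>M\<^esub> m"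
    by (auto simp: cyclic_submodule_def)
  then show "x \<oplus>\<^bsub>M\<^esub> y \<in> cyclic_submodule R M m"
    unfolding cyclic_submodule_def using m
    by (intro image_eqI[of _ _ "r \<oplus> t"]) (auto simp: smult_l_distr)
next
  fix a x assume "a \<in> carrier R" "x \<in> cyclic_submodule R M m"
  then obtain r where "a \<in> carrier R" "r \<in> carrier R" "x = r \<odot>\<^bsub>M\<^esub> m"
    by (auto simp: cyclic_submodule_def)
  then show "a \<odot>\<^bsub>M\<^esub> x \<in> cyclic_submodule R M m"
    unfolding cyclic_submodule_def using m
    by (intro image_eqI[of _ _ "a \<otimes> r"]) (auto simp: smult_assoc1)
qed

lemma cyclic_submodule_self:
  assumes "m \<in> carrier M"
  shows "m \<in> cyclic_submodule R M m"
  unfolding cyclic_submodule_def using assms by (intro image_eqI[of _ _ \<one>]) auto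

text \<open>The product \<open>(R a)(R m)\<close> is contained in \<open>R (a m)\<close> because \<open>R\<close> is
  commutative, hence in every submodule that contains \<open>a m\<close>.\<close>

lemma smult_cgenideal_cyclic:
  assumes N: "submodule N R M" and a: "a \<in> carrier R" and m: "m \<in> carrier M"
    and am: "a \<odot>\<^bsub>M\<^esub> m \<in> N" and i: "i \<in> PIdl a" and k: "k \<in> cyclic_submodule R M m"
  shows "i \<odot>\<^bsub>M\<^esub> k \<in> N"
proof -
  obtain r t where r: "r \<in> carrier R" "i = r \<otimes> a" and t: "t \<in> carrier R" "k = t \<odot>\<^bsub>M\<^esub> m"
    using i k by (auto simp: cgenideal_def cyclic_submodule_def)
  have "i \<odot>\<^bsub>M\<^esub> k = (r \<otimes> t) \<odot>\<^bsub>M\<^esub> (a \<odot>\<^bsub>M\<^esub> m)"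
    using r t a m by (simp add: smult_assoc1[symmetric] R.m_ac)
  then show ?thesis
    using submoduleE(4)[OF N _ am] r t by simp
qed

lemma mult_mem_ring_colon_carrier_iff:
  assumes "s \<in> carrier R" "a \<in> carrier R"
  shows "s \<otimes> a \<in> ring_colon R M N (carrier M) \<longleftrightarrow>
    a \<in> ring_colon R M N (elt_smult M s (carrier M))"
proof -
  have "(s \<otimes> a) \<odot>\<^bsub>M\<^esub> m = a \<odot>\<^bsub>M\<^esub> (s \<odot>\<^bsub>M\<^esub> m)" if "m \<in> carrier M" for m
    using assms that by (simp add: smult_assoc1[symmetric] R.m_comm)
  then show ?thesis
    using assms by (auto simp: ring_colon_def elt_smult_def)
qed

lemma ring_colon_carrier_add_cancel:
  assumes N: "submodule N R M" and r: "r \<in> ring_colon R M N (carrier M)"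
    and t: "t \<in> carrier R" and rt: "r \<oplus> t \<in> ring_colon R M N (carrier M)"
  shows "t \<in> ring_colon R M N (carrier M)"
proof -
  have "t \<odot>\<^bsub>M\<^esub> m \<in> N" if m: "m \<in> carrier M" for m
  proof (rule submodule_add_cancel[OF N])
    show "r \<odot>\<^bsub>M\<^esub> m \<in> N" "t \<odot>\<^bsub>M\<^esub> m \<in> carrier M"
      using r t m by (auto simp: ring_colon_def elt_smult_def)
    have "r \<in> carrier R" "(r \<oplus> t) \<odot>\<^bsub>M\<^esub> m \<in> N"
      using r rt m by (auto simp: ring_colon_def elt_smult_def)
    then show "r \<odot>\<^bsub>M\<^esub> m \<oplus>\<^bsub>M\<^esub> t \<odot>\<^bsub>M\<^esub> m \<in> N"
      using t m by (simp add: smult_l_distr)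
  qed
  then show ?thesis
    using t by (auto simp: ring_colon_def elt_smult_def)
qed

lemma elt_smult_neq_zero_iff:
  assumes "submodule K R M"
  shows "elt_smult M a K \<noteq> {\<zero>\<^bsub>M\<^esub>} \<longleftrightarrow> (\<exists>k\<in>K. a \<odot>\<^bsub>M\<^esub> k \<noteq> \<zero>\<^bsub>M\<^esub>)"
  using submodule_zero_closed[OF assms] by (auto simp: elt_smult_def)

lemma ideal_smult_subset:
  assumes N: "submodule N R M" and "\<And>i k. i \<in> I \<Longrightarrow> k \<in> K \<Longrightarrow> i \<odot>\<^bsub>M\<^esub> k \<in> N"
  shows "ideal_smult M I K \<subseteq> N"
proof
  fix x assume "x \<in> ideal_smult M I K"
  then show "x \<in> N"
    by induction (use assms submoduleE(5)[OF N] in auto)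
qed

lemma ideal_smult_neq_zero_imp:
  assumes I: "ideal I R" and K: "submodule K R M" and "ideal_smult M I K \<noteq> {\<zero>\<^bsub>M\<^esub>}"
  shows "\<exists>i\<in>I. \<exists>k\<in>K. i \<odot>\<^bsub>M\<^esub> k \<noteq> \<zero>\<^bsub>M\<^esub>"
proof (rule ccontr)
  assume no: "\<not> ?thesis"
  have "x = \<zero>\<^bsub>M\<^esub>" if "x \<in> ideal_smult M I K" for x
    using that by induction (use no in auto)
  then have "ideal_smult M I K \<subseteq> {\<zero>\<^bsub>M\<^esub>}"
    by blast
  moreover have "\<zero> \<odot>\<^bsub>M\<^esub> \<zero>\<^bsub>M\<^esub> \<in> ideal_smult M I K"
    using submodule_zero_closed[OF K] additive_subgroup.zero_closed[OF ideal.axioms(1)[OF I]]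
    by (rule ideal_smult.prod[rotated])
  ultimately show False
    using assms(3) subset_singletonD by fastforce
qed

section \<open>The colon dichotomy\<close>

text \<open>The witness condition gives
  \<open>(N : a) \<subseteq> (0 : a) \<union> (N : s)\<close>, and a submodule covered by two others
  lies in one of them: if \<open>x\<close> is in \<open>(N : a)\<close> but not in \<open>(0 : a)\<close>, then for
  every \<open>y \<in> (0 : a)\<close> also \<open>x + y\<close> is outside \<open>(0 : a)\<close>, so \<open>x\<close> and
  \<open>x + y\<close> are both in \<open>(N : s)\<close>, and so is \<open>y\<close>.\<close>

lemma prime_witness_colon_dichotomy:
  assumes N: "submodule N R M" and s: "s \<in> carrier R" and w: "prime_witness R M N s"
    and a: "a \<in> carrier R" and sa: "s \<otimes> a \<notin> ring_colon R M N (carrier M)"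
  shows "mod_colon M N a = mod_colon M {\<zero>\<^bsub>M\<^esub>} a \<or> mod_colon M N a \<subseteq> mod_colon M N s"
proof (cases "\<exists>x\<in>carrier M. a \<odot>\<^bsub>M\<^esub> x \<in> N \<and> a \<odot>\<^bsub>M\<^esub> x \<noteq> \<zero>\<^bsub>M\<^esub>")
  case False
  then show ?thesis
    using submodule_zero_closed[OF N] by (auto simp: mod_colon_def)
next
  case True
  then obtain x where x: "x \<in> carrier M" "a \<odot>\<^bsub>M\<^esub> x \<in> N" "a \<odot>\<^bsub>M\<^esub> x \<noteq> \<zero>\<^bsub>M\<^esub>"
    by blast
  have nonzero: "s \<odot>\<^bsub>M\<^esub> m \<in> N"
    if "m \<in> carrier M" "a \<odot>\<^bsub>M\<^esub> m \<in> N" "a \<odot>\<^bsub>M\<^esub> m \<noteq> \<zero>\<^bsub>M\<^esub>" for m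
    using w a sa that unfolding prime_witness_def by blast
  have "s \<odot>\<^bsub>M\<^esub> y \<in> N" if y: "y \<in> carrier M" "a \<odot>\<^bsub>M\<^esub> y \<in> N" for y
  proof (cases "a \<odot>\<^bsub>M\<^esub> y = \<zero>\<^bsub>M\<^esub>")
    case True
    then have "a \<odot>\<^bsub>M\<^esub> (x \<oplus>\<^bsub>M\<^esub> y) = a \<odot>\<^bsub>M\<^esub> x"
      using a x y by (simp add: smult_r_distr)
    then have "s \<odot>\<^bsub>M\<^esub> (x \<oplus>\<^bsub>M\<^esub> y) \<in> N"
      using nonzero[of "x \<oplus>\<^bsub>M\<^esub> y"] x y by simp
    then show ?thesis
      using submodule_add_cancel[OF N nonzero[OF x]] s x y by (simp add: smult_r_distr)
  qed (use nonzero y in blast)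
  then show ?thesis
    by (auto simp: mod_colon_def)
qed

lemma prime_witness_iff_colon_dichotomy:
  assumes N: "submodule N R M" and s: "s \<in> carrier R"
  shows "prime_witness R M N s \<longleftrightarrow>
    (\<forall>a\<in>carrier R. a \<notin> ring_colon R M N (elt_smult M s (carrier M)) \<longrightarrow>
      mod_colon M N a = mod_colon M {\<zero>\<^bsub>M\<^esub>} a \<or> mod_colon M N a \<subseteq> mod_colon M N s)"
    (is "_ \<longleftrightarrow> ?dichotomy")
proof
  assume "prime_witness R M N s"
  then show ?dichotomy
    using prime_witness_colon_dichotomy[OF N s] mult_mem_ring_colon_carrier_iff[OF s] by blast
next
  assume dichotomy: ?dichotomy
  show "prime_witness R M N s"
    unfolding prime_witness_def
  proof (intro ballI impI)
    fix a m assume a: "a \<in> carrier R" and m: "m \<in> carrier M"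
      and am: "a \<odot>\<^bsub>M\<^esub> m \<noteq> \<zero>\<^bsub>M\<^esub> \<and> a \<odot>\<^bsub>M\<^esub> m \<in> N"
    have "m \<in> mod_colon M N a" "m \<notin> mod_colon M {\<zero>\<^bsub>M\<^esub>} a"
      using m am by (auto simp: mod_colon_def)
    then have "a \<in> ring_colon R M N (elt_smult M s (carrier M)) \<or> m \<in> mod_colon M N s"
      using dichotomy a by blast
    then show "s \<otimes> a \<in> ring_colon R M N (carrier M) \<or> s \<odot>\<^bsub>M\<^esub> m \<in> N"
      using mult_mem_ring_colon_carrier_iff[OF s a] by (auto simp: mod_colon_def)
  qed
qed

section \<open>Products with submodules and with ideals\<close>

lemma prime_witness_iff_elt_smult_condition:
  assumes N: "submodule N R M" and s: "s \<in> carrier R"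
  shows "prime_witness R M N s \<longleftrightarrow>
    (\<forall>a\<in>carrier R. \<forall>K. submodule K R M \<longrightarrow>
      elt_smult M a K \<noteq> {\<zero>\<^bsub>M\<^esub>} \<and> elt_smult M a K \<subseteq> N \<longrightarrow>
        s \<otimes> a \<in> ring_colon R M N (carrier M) \<or> elt_smult M s K \<subseteq> N)"
    (is "_ \<longleftrightarrow> ?submodules")
proof
  assume w: "prime_witness R M N s"
  show ?submodules
  proof (intro ballI allI impI)
    fix a K assume a: "a \<in> carrier R" and K: "submodule K R M"
      and aK: "elt_smult M a K \<noteq> {\<zero>\<^bsub>M\<^esub>} \<and> elt_smult M a K \<subseteq> N"
    have "K \<subseteq> mod_colon M N a" "\<not> K \<subseteq> mod_colon M {\<zero>\<^bsub>M\<^esub>} a"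
      using aK submoduleE(1)[OF K] elt_smult_neq_zero_iff[OF K]
      by (auto simp: mod_colon_def elt_smult_def)
    then have "s \<otimes> a \<in> ring_colon R M N (carrier M) \<or> K \<subseteq> mod_colon M N s"
      using prime_witness_colon_dichotomy[OF N s w a] by blast
    then show "s \<otimes> a \<in> ring_colon R M N (carrier M) \<or> elt_smult M s K \<subseteq> N"
      by (auto simp: mod_colon_def elt_smult_def)
  qed
next
  assume submodules: ?submodules
  show "prime_witness R M N s"
    unfolding prime_witness_def
  proof (intro ballI impI)
    fix a m assume a: "a \<in> carrier R" and m: "m \<in> carrier M"
      and am: "a \<odot>\<^bsub>M\<^esub> m \<noteq> \<zero>\<^bsub>M\<^esub> \<and> a \<odot>\<^bsub>M\<^esub> m \<in> N"
    let ?K = "cyclic_submodule R M m"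
    note K = cyclic_submodule_is_submodule[OF m] and mK = cyclic_submodule_self[OF m]
    have "elt_smult M a ?K \<noteq> {\<zero>\<^bsub>M\<^esub>}"
      using elt_smult_neq_zero_iff[OF K] am mK by blast
    moreover have "elt_smult M a ?K \<subseteq> N"
      using smult_cgenideal_cyclic[OF N a m _ cgenideal_self[OF a]] am
      by (auto simp: elt_smult_def)
    ultimately show "s \<otimes> a \<in> ring_colon R M N (carrier M) \<or> s \<odot>\<^bsub>M\<^esub> m \<in> N"
      using submodules a K mK unfolding elt_smult_def by blast
  qed
qed

text \<open>If \<open>s K\<close> is not contained in \<open>N\<close>, the condition for single scalars says that
  \<open>I\<close> is the union of the additive subgroups \<open>{i. i K = 0}\<close> and
  \<open>{i. s i \<in> (N : M)}\<close>. The first one is proper because \<open>I K \<noteq> 0\<close>, so the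
  second one is all of \<open>I\<close>.\<close>

lemma prime_witness_imp_ideal_smult_condition:
  assumes N: "submodule N R M" and s: "s \<in> carrier R" and w: "prime_witness R M N s"
    and I: "ideal I R" and K: "submodule K R M"
    and IK: "ideal_smult M I K \<noteq> {\<zero>\<^bsub>M\<^esub>}" "ideal_smult M I K \<subseteq> N"
  shows "s <# I \<subseteq> ring_colon R M N (carrier M) \<or> elt_smult M s K \<subseteq> N"
proof (rule disjCI)
  assume sK: "\<not> elt_smult M s K \<subseteq> N"
  interpret I: ideal I R by (fact I)
  have KM: "K \<subseteq> carrier M" using submoduleE(1)[OF K] .
  have nonzero: "s \<otimes> i \<in> ring_colon R M N (carrier M)"
    if i: "i \<in> I" and k: "k \<in> K" "i \<odot>\<^bsub>M\<^esub> k \<noteq> \<zero>\<^bsub>M\<^esub>" for i k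
  proof -
    have "elt_smult M i K \<subseteq> N"
      using IK(2) i by (auto simp: elt_smult_def intro: ideal_smult.prod)
    moreover have "elt_smult M i K \<noteq> {\<zero>\<^bsub>M\<^esub>}"
      using elt_smult_neq_zero_iff[OF K] k by blast
    ultimately show ?thesis
      using prime_witness_iff_elt_smult_condition[OF N s] w K sK I.Icarr[OF i] by blast
  qed
  obtain j k where j: "j \<in> I" and k: "k \<in> K" "j \<odot>\<^bsub>M\<^esub> k \<noteq> \<zero>\<^bsub>M\<^esub>"
    using ideal_smult_neq_zero_imp[OF I K IK(1)] by blast
  have "s \<otimes> i \<in> ring_colon R M N (carrier M)" if i: "i \<in> I" for i
  proof (cases "i \<odot>\<^bsub>M\<^esub> k = \<zero>\<^bsub>M\<^esub>")
    case True
    have "(j \<oplus> i) \<odot>\<^bsub>M\<^esub> k = j \<odot>\<^bsub>M\<^esub> k"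
      using True i j k KM by (auto simp: smult_l_distr I.Icarr subset_iff)
    then have "s \<otimes> (j \<oplus> i) \<in> ring_colon R M N (carrier M)"
      using nonzero[of "j \<oplus> i" k] i j k by simp
    then have "s \<otimes> j \<oplus> s \<otimes> i \<in> ring_colon R M N (carrier M)"
      using s i j by (simp add: R.r_distr I.Icarr)
    then show ?thesis
      using ring_colon_carrier_add_cancel[OF N nonzero[OF j k]] s i by (simp add: I.Icarr)
  qed (use nonzero i k in blast)
  then show "s <# I \<subseteq> ring_colon R M N (carrier M)"
    by (auto simp: l_coset_def)
qed

lemma prime_witness_iff_ideal_smult_condition:
  assumes N: "submodule N R M" and s: "s \<in> carrier R"
  shows "prime_witness R M N s \<longleftrightarrow>
    (\<forall>I K. ideal I R \<longrightarrow> submodule K R M \<longrightarrow>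
      ideal_smult M I K \<noteq> {\<zero>\<^bsub>M\<^esub>} \<and> ideal_smult M I K \<subseteq> N \<longrightarrow>
        s <# I \<subseteq> ring_colon R M N (carrier M) \<or> elt_smult M s K \<subseteq> N)"
    (is "_ \<longleftrightarrow> ?ideals")
proof
  assume "prime_witness R M N s"
  then show ?ideals
    using prime_witness_imp_ideal_smult_condition[OF N s] by blast
next
  assume ideals: ?ideals
  show "prime_witness R M N s"
    unfolding prime_witness_def
  proof (intro ballI impI)
    fix a m assume a: "a \<in> carrier R" and m: "m \<in> carrier M"
      and am: "a \<odot>\<^bsub>M\<^esub> m \<noteq> \<zero>\<^bsub>M\<^esub> \<and> a \<odot>\<^bsub>M\<^esub> m \<in> N"
    let ?I = "PIdl a" and ?K = "cyclic_submodule R M m"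
    note aI = cgenideal_self[OF a] and mK = cyclic_submodule_self[OF m]
    have "ideal_smult M ?I ?K \<noteq> {\<zero>\<^bsub>M\<^esub>}"
      using ideal_smult.prod[OF aI mK, of M] am by blast
    moreover have "ideal_smult M ?I ?K \<subseteq> N"
      using ideal_smult_subset[OF N] smult_cgenideal_cyclic[OF N a m] am by blast
    ultimately have "s <# ?I \<subseteq> ring_colon R M N (carrier M) \<or> elt_smult M s ?K \<subseteq> N"
      using ideals cgenideal_ideal[OF a] cyclic_submodule_is_submodule[OF m] by blast
    then show "s \<otimes> a \<in> ring_colon R M N (carrier M) \<or> s \<odot>\<^bsub>M\<^esub> m \<in> N"
      using aI mK by (auto simp: l_coset_def elt_smult_def)
  qed
qed

end

section \<open>Characterisations of weakly S-prime submodules\<close>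

theorem theorem1:
  fixes R :: "('a, 'r) ring_scheme"
    and M :: "('a, 'b, 'm) module_scheme"
    and S :: "'a set"
    and N :: "'b set"
  assumes "module R M"
    and "\<one>\<^bsub>R\<^esub> \<noteq> \<zero>\<^bsub>R\<^esub>"
    and "mult_closed_subset R S"
    and "submodule N R M"
    and "ring_colon R M N (carrier M) \<inter> S = {}"
  shows
    "(weakly_S_prime R M S N \<longleftrightarrow>
      (\<exists>s\<in>S. \<forall>a\<in>carrier R.
        a \<notin> ring_colon R M N (elt_smult M s (carrier M)) \<longrightarrow>
          mod_colon M N a = mod_colon M {\<zero>\<^bsub>M\<^esub>} a \<or> mod_colon M N a \<subseteq> mod_colon M N s)) \<and>
     (weakly_S_prime R M S N \<longleftrightarrow>
      (\<exists>s\<in>S. \<forall>a\<in>carrier R. \<forall>K.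
        submodule K R M \<longrightarrow> elt_smult M a K \<noteq> {\<zero>\<^bsub>M\<^esub>} \<and> elt_smult M a K \<subseteq> N \<longrightarrow>
          s \<otimes>\<^bsub>R\<^esub> a \<in> ring_colon R M N (carrier M) \<or> elt_smult M s K \<subseteq> N)) \<and>
     (weakly_S_prime R M S N \<longleftrightarrow>
      (\<exists>s\<in>S. \<forall>I K.
        ideal I R \<longrightarrow> submodule K R M \<longrightarrow>
        ideal_smult M I K \<noteq> {\<zero>\<^bsub>M\<^esub>} \<and> ideal_smult M I K \<subseteq> N \<longrightarrow>
          s <#\<^bsub>R\<^esub> I \<subseteq> ring_colon R M N (carrier M) \<or> elt_smult M s K \<subseteq> N))"
proof -
  interpret module R M by (fact assms(1))
  have S: "s \<in> carrier R" if "s \<in> S" for s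
    using assms(3) that by (auto simp: mult_closed_subset_def)
  have weak: "weakly_S_prime R M S N \<longleftrightarrow> (\<exists>s\<in>S. prime_witness R M N s)"
    using assms(4,5) by (simp add: weakly_S_prime_def prime_witness_def)
  show ?thesis
    unfolding weak
    by (intro conjI bex_cong[OF refl] prime_witness_iff_colon_dichotomy[OF assms(4) S]
        prime_witness_iff_elt_smult_condition[OF assms(4) S]
        prime_witness_iff_ideal_smult_condition[OF assms(4) S])
qed

end
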